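(* Let $M\in\mathbb{R}^{n\times n}$ and $r\in\mathbb{R}^n$, and suppose that the bilinear optimization problem (BLO) is feasible. Let $(c^*,x^*,y^* )$ be a global optimal solution of (BLO). If $(c^* )^Tx^*-r^Ty^*=0$, then $x^*$ is a solution of the LCP. If $(c^* )^Tx^*-r^Ty^*>0$, then the LCP is infeasible (has no solution).
   Context: Given $M\in\mathbb{R}^{n\times n}$ and $r\in\mathbb{R}^n$, the linear complementarity problem (LCP) is to find $x\in\mathbb{R}^n$ with $Mx\ge r$, $x\ge 0$, $x^T(Mx-r)=0$. The bilinear optimization problem (BLO), with decision variables $c,x,y\in\mathbb{R}^n$, is $$\min\ c^Tx-r^Ty\quad\text{s.t.}\quad Mx\ge r,\ \ M^Ty\le c,\ \ x\le y,\ \ x,y\ge 0.$$ Vector inequalities are component-wise. *)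

theory Defs
  imports "HOL-Analysis.Analysis"
begin

text \<open>
  Vector inequalities are the library order on \<^typ>\<open>real ^ 'n\<close>, which is
  component-wise (\<open>less_eq_vec_def\<close>).
\<close>

definition lcp_solution :: "real ^ 'n ^ 'n \<Rightarrow> real ^ 'n \<Rightarrow> real ^ 'n \<Rightarrow> bool" where
  "lcp_solution M r x \<longleftrightarrow> M *v x \<ge> r \<and> x \<ge> 0 \<and> x \<bullet> (M *v x - r) = 0"

definition blo_objective :: "real ^ 'n \<Rightarrow> real ^ 'n \<Rightarrow> real ^ 'n \<Rightarrow> real ^ 'n \<Rightarrow> real" where
  "blo_objective r c x y = c \<bullet> x - r \<bullet> y"

definition blo_feasible ::
  "real ^ 'n ^ 'n \<Rightarrow> real ^ 'n \<Rightarrow> real ^ 'n \<Rightarrow> real ^ 'n \<Rightarrow> real ^ 'n \<Rightarrow> bool" where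
  "blo_feasible M r c x y \<longleftrightarrow>
     M *v x \<ge> r \<and> transpose M *v y \<le> c \<and> x \<le> y \<and> x \<ge> 0 \<and> y \<ge> 0"

definition blo_optimal ::
  "real ^ 'n ^ 'n \<Rightarrow> real ^ 'n \<Rightarrow> real ^ 'n \<Rightarrow> real ^ 'n \<Rightarrow> real ^ 'n \<Rightarrow> bool" where
  "blo_optimal M r c x y \<longleftrightarrow>
     blo_feasible M r c x y \<and>
     (\<forall>c' x' y'. blo_feasible M r c' x' y' \<longrightarrow> blo_objective r c x y \<le> blo_objective r c' x' y')"

end

theory Submission
  imports Defs
begin

text \<open>
  The bilinear objective bounds the complementarity gap \<open>x \<bullet> (M *v x - r)\<close> from above on the
  feasible set: for nonnegative \<open>x\<close> the constraint on \<open>c\<close> gives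
  \<open>c \<bullet> x \<ge> (transpose M *v y) \<bullet> x = y \<bullet> (M *v x)\<close>, hence the objective is at least
  \<open>y \<bullet> (M *v x - r)\<close>, and the slack \<open>M *v x - r\<close> is nonnegative, so \<open>y\<close> may be
  lowered to \<open>x\<close> (\<open>complementarity_gap_le_objective\<close>). The gap itself is nonnegative, so the
  objective can vanish only at a point \<open>x\<close> that solves the LCP. Conversely the bound is attained:
  an LCP solution \<open>x\<close> yields the feasible triple \<open>(transpose M *v x, x, x)\<close>, at which every
  estimate above is an equality, so the objective is zero
  (\<open>lcp_solution_gives_zero_objective\<close>). A positive minimum therefore excludes solutions.
\<close>

lemma inner_mono_vec:
  fixes a b z :: "real ^ 'n"
  assumes "a \<le> b" and "0 \<le> z"
  shows "a \<bullet> z \<le> b \<bullet> z"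
  using assms by (auto simp: inner_vec_def less_eq_vec_def intro!: sum_mono mult_right_mono)

lemma complementarity_gap_nonneg:
  assumes "blo_feasible M r c x y"
  shows "0 \<le> x \<bullet> (M *v x - r)"
  using assms inner_mono_vec[of 0 x "M *v x - r"] by (simp add: blo_feasible_def)

text \<open>
  The two constraints that tie \<open>y\<close> to \<open>c\<close> and \<open>x\<close> are each paired with a nonnegative vector:
  \<open>transpose M *v y \<le> c\<close> with \<open>x\<close>, and \<open>x \<le> y\<close> with the slack \<open>M *v x - r\<close>.
\<close>

lemma complementarity_gap_le_objective:
  assumes "blo_feasible M r c x y"
  shows "x \<bullet> (M *v x - r) \<le> blo_objective r c x y"
proof -
  have "x \<bullet> (M *v x - r) \<le> y \<bullet> (M *v x - r)"
    using assms by (intro inner_mono_vec) (simp_all add: blo_feasible_def)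
  also have "\<dots> = (transpose M *v y) \<bullet> x - r \<bullet> y"
    by (simp add: inner_diff_right inner_commute[of y r] dot_lmul_matrix
        flip: vector_transpose_matrix)
  also have "\<dots> \<le> c \<bullet> x - r \<bullet> y"
    using assms inner_mono_vec[of "transpose M *v y" c x] by (simp add: blo_feasible_def)
  finally show ?thesis by (simp add: blo_objective_def)
qed

lemma lcp_solution_gives_zero_objective:
  assumes "lcp_solution M r x"
  shows "blo_feasible M r (transpose M *v x) x x"
    and "blo_objective r (transpose M *v x) x x = 0"
proof -
  show "blo_feasible M r (transpose M *v x) x x"
    using assms by (simp add: lcp_solution_def blo_feasible_def)
  have "blo_objective r (transpose M *v x) x x = x \<bullet> (M *v x - r)"
    by (simp add: blo_objective_def inner_diff_right inner_commute[of x r] dot_lmul_matrix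
        flip: vector_transpose_matrix)
  with assms show "blo_objective r (transpose M *v x) x x = 0"
    by (simp add: lcp_solution_def)
qed

theorem proposition2p3:
  fixes M :: "real ^ 'n ^ 'n" and r cs xs ys :: "real ^ 'n"
  assumes "\<exists>c x y. blo_feasible M r c x y"
    and "blo_optimal M r cs xs ys"
  shows "(cs \<bullet> xs - r \<bullet> ys = 0 \<longrightarrow> lcp_solution M r xs) \<and>
         (cs \<bullet> xs - r \<bullet> ys > 0 \<longrightarrow> \<not> (\<exists>x. lcp_solution M r x))"
proof (intro conjI impI notI)
  have feas: "blo_feasible M r cs xs ys"
    using assms(2) by (simp add: blo_optimal_def)
  assume "cs \<bullet> xs - r \<bullet> ys = 0"
  with complementarity_gap_le_objective[OF feas] complementarity_gap_nonneg[OF feas]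
  have "xs \<bullet> (M *v xs - r) = 0"
    by (simp add: blo_objective_def)
  with feas show "lcp_solution M r xs"
    by (simp add: lcp_solution_def blo_feasible_def)
next
  assume pos: "cs \<bullet> xs - r \<bullet> ys > 0" and "\<exists>x. lcp_solution M r x"
  then obtain x where "lcp_solution M r x" by blast
  note zero = lcp_solution_gives_zero_objective[OF this]
  have "blo_objective r cs xs ys \<le> blo_objective r (transpose M *v x) x x"
    using assms(2) zero(1) by (simp add: blo_optimal_def)
  with zero(2) pos show False
    by (simp add: blo_objective_def)
qed

end
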